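(* Let $(H,d)$ be a Hadamard space, let $(X_n)_{n\ge1}$ be a sequence of random variables in $\mathcal{L}^2(H)$ on a common probability space (not assumed independent or identically distributed) with expectations $\mathbb{E}(X_n)=\mu_n$, and let $\mu\in H$. Let $b_n$ be the Fréchet mean of $X_1,\dots,X_n$. Assume $\sup_{n\in\mathbb{N}}\mathrm{Var}(X_n)<\infty$ and $\frac1n\sum_{k=1}^n d(\mu,\mu_k)^2\to0$. If a subsequence $b_{n_m}$ of $b_n$ converges to some point $z\in H$ in $\mathcal{L}^2(H)$, then $z=\mu$.
   Context: A Hadamard space is a complete metric space $(H,d)$ such that for all $x,y\in H$ there is $m\in H$ with $d(z,m)^2\le\frac12 d(z,x)^2+\frac12 d(z,y)^2-\frac14 d(x,y)^2$ for all $z\in H$. The Fréchet mean of $x_1,\dots,x_n\in H$ is the unique minimizer $b_n=\operatorname{arg\,min}_{z\in H}\frac1n\sum_{k=1}^n d(x_k,z)^2$ (applied pointwise to random variables). A random variable in $H$ is a Borel measurable map from a probability space to $H$; $X\in\mathcal{L}^p(H)$ ($p\ge1$) means $\mathbb{E}(d(X,z)^p)<\infty$ for some (equivalently all) $z\in H$. For $X\in\mathcal{L}^2(H)$, $\mathbb{E}(X)$ is the unique minimizer of $z\mapsto\mathbb{E}(d(X,z)^2)$ over $H$, and $\mathrm{Var}(X)=\mathbb{E}(d(X,\mathbb{E}(X))^2)$. $Z_n\to Z$ in $\mathcal{L}^2(H)$ means $\mathbb{E}(d(Z_n,Z)^2)\to0$. *)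

theory Defs
  imports "HOL-Probability.Probability"
begin

class hadamard_space = complete_space +
  assumes hadamard_midpoint:
    "\<exists>m. \<forall>z. (dist z m)\<^sup>2 \<le> (dist z x)\<^sup>2 / 2 + (dist z y)\<^sup>2 / 2 - (dist x y)\<^sup>2 / 4"

text \<open>The minimizers selected below with \<^const>\<open>arg_min\<close> exist and are unique in a Hadamard
  space: for \<open>n \<ge> 1\<close> points, and for random variables in \<open>L2\<close>, respectively.\<close>

definition frechet_mean :: "nat \<Rightarrow> (nat \<Rightarrow> 'a::hadamard_space) \<Rightarrow> 'a" where
  "frechet_mean n x = arg_min (\<lambda>z. (1 / real n) * (\<Sum>k=1..n. (dist (x k) z)\<^sup>2)) (\<lambda>z. True)"

definition L2 :: "'w measure \<Rightarrow> ('w \<Rightarrow> 'a::metric_space) set" where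
  "L2 M = {X \<in> borel_measurable M. \<exists>z. integrable M (\<lambda>w. (dist (X w) z)\<^sup>2)}"

definition H_expectation :: "'w measure \<Rightarrow> ('w \<Rightarrow> 'a::hadamard_space) \<Rightarrow> 'a" where
  "H_expectation M X = arg_min (\<lambda>z. \<integral>w. (dist (X w) z)\<^sup>2 \<partial>M) (\<lambda>z. True)"

definition H_variance :: "'w measure \<Rightarrow> ('w \<Rightarrow> 'a::hadamard_space) \<Rightarrow> real" where
  "H_variance M X = (\<integral>w. (dist (X w) (H_expectation M X))\<^sup>2 \<partial>M)"

text \<open>Convergence in \<open>L2\<close> is between elements of \<open>L2\<close>. The nonnegative integral is used because
  the Bochner integral of a non-integrable function is \<open>0\<close>.\<close>

definition L2_converges ::
    "'w measure \<Rightarrow> (nat \<Rightarrow> 'w \<Rightarrow> 'a::metric_space) \<Rightarrow> ('w \<Rightarrow> 'a) \<Rightarrow> bool" where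
  "L2_converges M Z Z' \<longleftrightarrow>
     (\<forall>n. Z n \<in> L2 M) \<and> Z' \<in> L2 M \<and>
     (\<lambda>n. \<integral>\<^sup>+w. ennreal ((dist (Z n w) (Z' w))\<^sup>2) \<partial>M) \<longlonglongrightarrow> 0"

end

theory Submission
  imports Defs
begin

text \<open>
  Write \<open>V\<close>, \<open>A\<close>, \<open>B\<close> for the averages over \<open>k \<le> n\<close> of the mean squared distances of \<open>X\<^sub>k\<close> to
  its own expectation \<open>\<mu>\<^sub>k\<close>, to \<open>\<mu>\<close>, and to \<open>z\<close>. Minimality compares them in a cycle. Since
  \<open>\<mu>\<^sub>k\<close> minimizes a strongly convex functional, moving from \<open>\<mu>\<^sub>k\<close> to \<open>z\<close> has a price:
  \<open>B\<close> exceeds \<open>V\<close> by a fixed multiple of \<open>d(z, \<mu>)\<^sup>2\<close>, up to an error that vanishes because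
  the \<open>\<mu>\<^sub>k\<close> are close to \<open>\<mu>\<close> on average. On the other hand \<open>b\<^sub>n\<close> is close to \<open>z\<close> and
  is at least as good a centre for the sample as \<open>\<mu>\<close>, so \<open>B\<close> is at most \<open>A\<close> up to a small
  error; and \<open>A\<close> is close to \<open>V\<close>, again because the \<open>\<mu>\<^sub>k\<close> are close to \<open>\<mu>\<close> on average.
  Hence \<open>d(z, \<mu>) = 0\<close>. The observations may depend on each other because \<open>b\<^sub>n\<close> is compared
  with \<open>\<mu>\<close> pointwise, before taking the integral.

  The word ``close'' is made quantitative by the weighted triangle inequality
  \<open>d(p,z)\<^sup>2 \<le> (1+e) d(p,y)\<^sup>2 + (1+1/e) d(y,z)\<^sup>2\<close> (lemma \<open>dist_square_weighted_triangle\<close>). It is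
  linear in squared distances, so it survives averaging and integration without the
  Cauchy-Schwarz inequality. Its multiplicative loss \<open>e\<close> is harmless because \<open>V\<close> is bounded by
  the supremum of the variances; \<open>e\<close> is sent to \<open>0\<close> after \<open>n\<close> goes to infinity.

  The expectation and the Frechet mean are both minimizers of functionals that inherit this
  inequality and the midpoint inequality of the space. These two properties suffice for a
  minimizer to exist (lemma \<open>midpoint_convex_has_minimizer\<close>) and for the growth of the functional
  away from it (lemma \<open>midpoint_convex_growth\<close>).
\<close>

section \<open>Minimizers of midpoint-convex functionals\<close>

lemma dist_square_weighted_triangle:
  fixes p y z :: "'a::metric_space"
  assumes "e > 0"
  shows "(dist p z)\<^sup>2 \<le> (1 + e) * (dist p y)\<^sup>2 + (1 + 1/e) * (dist y z)\<^sup>2"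
proof -
  define s where "s = dist p y"
  define t where "t = dist y z"
  have "(dist p z)\<^sup>2 \<le> (s + t)\<^sup>2"
    unfolding s_def t_def by (intro power_mono dist_triangle) simp
  also have "(s + t)\<^sup>2 = (1 + e) * s\<^sup>2 + (1 + 1/e) * t\<^sup>2 - (e * s - t)\<^sup>2 / e"
    using assms by (simp add: field_simps power2_eq_square)
  also have "\<dots> \<le> (1 + e) * s\<^sup>2 + (1 + 1/e) * t\<^sup>2"
    using assms by simp
  finally show ?thesis unfolding s_def t_def .
qed

text \<open>By the midpoint inequality, two points with almost minimal values are close to each other.
  Hence a minimizing sequence is Cauchy. The weighted triangle inequality stands in for lower
  semicontinuity and shows that the limit is a minimizer.\<close>

lemma midpoint_convex_has_minimizer:
  fixes f :: "'a::complete_space \<Rightarrow> real"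
  assumes nonneg: "\<And>x. 0 \<le> f x"
    and mid: "\<And>x y. \<exists>m. f m \<le> f x / 2 + f y / 2 - (dist x y)\<^sup>2 / 4"
    and pert: "\<And>e x y. e > 0 \<Longrightarrow> f y \<le> (1 + e) * f x + (1 + 1/e) * (dist x y)\<^sup>2"
  shows "\<exists>x. \<forall>y. f x \<le> f y"
proof -
  define I where "I = (INF x. f x)"
  have bdd: "bdd_below (range f)" using nonneg by (auto intro!: bdd_belowI)
  have I_le: "I \<le> f x" for x unfolding I_def by (intro cINF_lower bdd) auto
  have "\<exists>x. f x < I + 1 / real (Suc n)" for n
    using cInf_lessD[of "range f" "I + 1 / real (Suc n)"] unfolding I_def by auto
  then obtain x where x: "\<And>n. f (x n) < I + 1 / real (Suc n)" by metis
  have close: "(dist (x m) (x n))\<^sup>2 \<le> 2 / real (Suc m) + 2 / real (Suc n)" for m n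
  proof -
    obtain c where "f c \<le> f (x m) / 2 + f (x n) / 2 - (dist (x m) (x n))\<^sup>2 / 4"
      using mid by blast
    with I_le[of c] x[of m] x[of n]
    have "(dist (x m) (x n))\<^sup>2 \<le> 2 * (1 / real (Suc m)) + 2 * (1 / real (Suc n))" by linarith
    then show ?thesis by simp
  qed
  have "Cauchy x"
  proof (rule metric_CauchyI)
    fix e :: real assume "e > 0"
    then obtain N where N: "1 / real (Suc N) < e\<^sup>2 / 4"
      using nat_approx_posE[of "e\<^sup>2/4"] by auto
    have "dist (x m) (x n) < e" if "m \<ge> N" "n \<ge> N" for m n
    proof -
      have "1 / real (Suc m) \<le> 1 / real (Suc N)" "1 / real (Suc n) \<le> 1 / real (Suc N)"
        using that by (auto intro!: divide_left_mono)
      with close[of m n] N have "(dist (x m) (x n))\<^sup>2 < e\<^sup>2" by linarith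
      with \<open>e > 0\<close> show ?thesis using power_less_imp_less_base[of _ 2 e] by simp
    qed
    then show "\<exists>N. \<forall>m\<ge>N. \<forall>n\<ge>N. dist (x m) (x n) < e" by blast
  qed
  then obtain c where c: "x \<longlonglongrightarrow> c" using Cauchy_convergent_iff convergent_def by blast
  have le: "f c \<le> (1 + e) * I" if e: "e > 0" for e
  proof (rule LIMSEQ_le_const)
    have "(\<lambda>n. 1 / real (Suc n)) \<longlonglongrightarrow> 0" by (rule LIMSEQ_Suc) (rule lim_1_over_n)
    moreover have "(\<lambda>n. dist (x n) c) \<longlonglongrightarrow> 0" by (rule tendsto_dist_iff[THEN iffD1, OF c])
    ultimately have "(\<lambda>n. (1 + e) * (I + 1 / real (Suc n)) + (1 + 1/e) * (dist (x n) c)\<^sup>2)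
        \<longlonglongrightarrow> (1 + e) * (I + 0) + (1 + 1/e) * 0\<^sup>2"
      by (intro tendsto_intros)
    then show "(\<lambda>n. (1 + e) * (I + 1 / real (Suc n)) + (1 + 1/e) * (dist (x n) c)\<^sup>2)
        \<longlonglongrightarrow> (1 + e) * I" by simp
    have "f c \<le> (1 + e) * (I + 1 / real (Suc n)) + (1 + 1/e) * (dist (x n) c)\<^sup>2" for n
    proof -
      have "(1 + e) * f (x n) \<le> (1 + e) * (I + 1 / real (Suc n))"
        using e x[of n] by (intro mult_left_mono) auto
      then show ?thesis using pert[OF e, of c "x n"] by linarith
    qed
    then show "\<exists>N. \<forall>n\<ge>N. f c \<le> (1 + e) * (I + 1 / real (Suc n)) + (1 + 1/e) * (dist (x n) c)\<^sup>2"
      by blast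
  qed
  have "((\<lambda>e. (1 + e) * I) \<longlongrightarrow> (1 + 0) * I) (at_right 0)" by (intro tendsto_intros)
  then have "f c \<le> (1 + 0) * I"
    by (rule tendsto_lowerbound)
      (rule eventually_mono[OF eventually_at_right_less], rule le, simp_all)
  with I_le show ?thesis by (metis add_0_right mult_1 order.trans)
qed

text \<open>Comparing the value at the minimizer with the value at a midpoint gives the constant
  \<open>1/2\<close>. The optimal constant is \<open>1\<close>, but any positive constant separates \<open>z\<close> from \<open>\<mu>\<close>.\<close>

lemma midpoint_convex_growth:
  fixes f :: "'a::metric_space \<Rightarrow> real"
  assumes min: "\<And>y. f c \<le> f y"
    and mid: "\<And>x y. \<exists>m. f m \<le> f x / 2 + f y / 2 - (dist x y)\<^sup>2 / 4"
  shows "f c + (dist c y)\<^sup>2 / 2 \<le> f y"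
proof -
  obtain m where "f m \<le> f c / 2 + f y / 2 - (dist c y)\<^sup>2 / 4" using mid by blast
  with min[of m] show ?thesis by simp
qed

lemma arg_min_minimizes:
  fixes f :: "'a \<Rightarrow> real"
  assumes "\<exists>x. \<forall>y. f x \<le> f y"
  shows "f (arg_min f (\<lambda>_. True)) \<le> f y"
proof -
  from assms obtain x where "\<And>y. f x \<le> f y" by blast
  then show ?thesis
    by (intro arg_minI[where P = "\<lambda>_. True" and f = f and x = x and
          Q = "\<lambda>c. f c \<le> f y"]) (auto simp: not_less)
qed

section \<open>Minimality of the Frechet mean\<close>

lemma frechet_mean_minimizes:
  fixes x :: "nat \<Rightarrow> 'a::hadamard_space"
  assumes n: "n \<ge> 1"
  shows "(\<Sum>k=1..n. (dist (x k) (frechet_mean n x))\<^sup>2) \<le> (\<Sum>k=1..n. (dist (x k) y)\<^sup>2)"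
proof -
  define f where "f = (\<lambda>z. (1 / real n) * (\<Sum>k=1..n. (dist (x k) z)\<^sup>2))"
  have f_const: "a = (1 / real n) * (\<Sum>k=1..n. a)" for a :: real
    using n by simp
  have "\<exists>c. \<forall>y. f c \<le> f y"
  proof (rule midpoint_convex_has_minimizer)
    show "0 \<le> f u" for u unfolding f_def by (simp add: sum_nonneg)
    show "\<exists>m. f m \<le> f u / 2 + f v / 2 - (dist u v)\<^sup>2 / 4" for u v
    proof -
      obtain m where m: "\<And>w. (dist w m)\<^sup>2 \<le> (dist w u)\<^sup>2 / 2 + (dist w v)\<^sup>2 / 2 - (dist u v)\<^sup>2 / 4"
        using hadamard_midpoint by metis
      have "f m \<le> (1 / real n) *
          (\<Sum>k=1..n. (dist (x k) u)\<^sup>2 / 2 + (dist (x k) v)\<^sup>2 / 2 - (dist u v)\<^sup>2 / 4)"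
        unfolding f_def by (intro mult_left_mono sum_mono m) simp
      also have "\<dots> = f u / 2 + f v / 2 - (1 / real n) * (\<Sum>k=1..n. (dist u v)\<^sup>2 / 4)"
        unfolding f_def
        by (simp only: sum.distrib sum_subtractf sum_divide_distrib[symmetric]) (simp add: algebra_simps)
      finally show ?thesis unfolding f_const[symmetric] by blast
    qed
    show "f v \<le> (1 + e) * f u + (1 + 1/e) * (dist u v)\<^sup>2" if "e > 0" for e u v
    proof -
      have "f v \<le> (1 / real n) *
          (\<Sum>k=1..n. (1 + e) * (dist (x k) u)\<^sup>2 + (1 + 1/e) * (dist u v)\<^sup>2)"
        unfolding f_def
        by (intro mult_left_mono sum_mono dist_square_weighted_triangle that) simp
      also have "\<dots> = (1 + e) * f u + (1 / real n) * (\<Sum>k=1..n. (1 + 1/e) * (dist u v)\<^sup>2)"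
        unfolding f_def
        by (simp only: sum.distrib sum_distrib_left[symmetric]) (simp add: algebra_simps add_divide_distrib)
      finally show ?thesis unfolding f_const[symmetric] .
    qed
  qed
  then have "f (frechet_mean n x) \<le> f y"
    unfolding frechet_mean_def f_def by (rule arg_min_minimizes)
  then show ?thesis using n by (simp add: f_def divide_right_mono field_simps)
qed

section \<open>Mean squared distances of a random variable\<close>

context prob_space
begin

lemma L2_integrable_dist_square:
  fixes X :: "'a \<Rightarrow> 'b::metric_space"
  assumes "X \<in> L2 M"
  shows "integrable M (\<lambda>w. (dist (X w) z)\<^sup>2)"
proof -
  from assms obtain y where X: "X \<in> borel_measurable M"
    and y: "integrable M (\<lambda>w. (dist (X w) y)\<^sup>2)" unfolding L2_def by auto
  have meas: "(\<lambda>w. (dist (X w) z)\<^sup>2) \<in> borel_measurable M"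
    by (rule borel_measurable_continuous_on[OF _ X, where f = "\<lambda>p. (dist p z)\<^sup>2"])
      (intro continuous_intros)
  have "integrable M (\<lambda>w. (1 + 1) * (dist (X w) y)\<^sup>2 + (1 + 1/1) * (dist y z)\<^sup>2)"
    using y by (intro Bochner_Integration.integrable_add integrable_mult_right) auto
  then show ?thesis
  proof (rule Bochner_Integration.integrable_bound[OF _ meas], intro AE_I2)
    fix w
    show "norm ((dist (X w) z)\<^sup>2)
        \<le> norm ((1 + 1) * (dist (X w) y)\<^sup>2 + (1 + 1/1) * (dist y z)\<^sup>2)"
      using dist_square_weighted_triangle[of 1 "X w" z y] by simp
  qed
qed

lemma mean_square_weighted_triangle:
  fixes X :: "'a \<Rightarrow> 'b::metric_space"
  assumes X: "X \<in> L2 M" and e: "e > 0"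
  shows "(\<integral>w. (dist (X w) z)\<^sup>2 \<partial>M)
    \<le> (1 + e) * (\<integral>w. (dist (X w) y)\<^sup>2 \<partial>M) + (1 + 1/e) * (dist y z)\<^sup>2"
proof -
  note int = L2_integrable_dist_square[OF X]
  have "(\<integral>w. (dist (X w) z)\<^sup>2 \<partial>M)
      \<le> (\<integral>w. (1 + e) * (dist (X w) y)\<^sup>2 + (1 + 1/e) * (dist y z)\<^sup>2 \<partial>M)"
    by (intro integral_mono int dist_square_weighted_triangle e
        Bochner_Integration.integrable_add integrable_mult_right) auto
  also have "\<dots> = (1 + e) * (\<integral>w. (dist (X w) y)\<^sup>2 \<partial>M) + (1 + 1/e) * (dist y z)\<^sup>2"
    using int by (simp add: prob_space)
  finally show ?thesis .
qed

lemma mean_square_midpoint: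
  fixes X :: "'a \<Rightarrow> 'b::hadamard_space"
  assumes X: "X \<in> L2 M"
  shows "\<exists>m. (\<integral>w. (dist (X w) m)\<^sup>2 \<partial>M)
    \<le> (\<integral>w. (dist (X w) u)\<^sup>2 \<partial>M) / 2 + (\<integral>w. (dist (X w) v)\<^sup>2 \<partial>M) / 2 - (dist u v)\<^sup>2 / 4"
proof -
  note int = L2_integrable_dist_square[OF X]
  obtain m where m: "\<And>p. (dist p m)\<^sup>2 \<le> (dist p u)\<^sup>2 / 2 + (dist p v)\<^sup>2 / 2 - (dist u v)\<^sup>2 / 4"
    using hadamard_midpoint by metis
  have "(\<integral>w. (dist (X w) m)\<^sup>2 \<partial>M)
      \<le> (\<integral>w. (dist (X w) u)\<^sup>2 / 2 + (dist (X w) v)\<^sup>2 / 2 - (dist u v)\<^sup>2 / 4 \<partial>M)"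
    by (intro integral_mono int m Bochner_Integration.integrable_add
        Bochner_Integration.integrable_diff integrable_divide) auto
  also have "\<dots> = (\<integral>w. (dist (X w) u)\<^sup>2 \<partial>M) / 2 + (\<integral>w. (dist (X w) v)\<^sup>2 \<partial>M) / 2
      - (dist u v)\<^sup>2 / 4"
    using int by (simp add: prob_space)
  finally show ?thesis by blast
qed

lemma mean_square_growth:
  fixes X :: "'a \<Rightarrow> 'b::hadamard_space"
  assumes X: "X \<in> L2 M"
  shows "H_variance M X + (dist (H_expectation M X) y)\<^sup>2 / 2 \<le> (\<integral>w. (dist (X w) y)\<^sup>2 \<partial>M)"
proof -
  define f where "f = (\<lambda>z. \<integral>w. (dist (X w) z)\<^sup>2 \<partial>M)"
  have mid: "\<exists>m. f m \<le> f u / 2 + f v / 2 - (dist u v)\<^sup>2 / 4" for u v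
    unfolding f_def by (rule mean_square_midpoint[OF X])
  have "\<exists>c. \<forall>y. f c \<le> f y"
    by (rule midpoint_convex_has_minimizer[OF _ mid])
      (auto simp: f_def intro: mean_square_weighted_triangle[OF X])
  then have "f (H_expectation M X) \<le> f u" for u
    unfolding H_expectation_def f_def by (rule arg_min_minimizes)
  then have "f (H_expectation M X) + (dist (H_expectation M X) y)\<^sup>2 / 2 \<le> f y"
    by (rule midpoint_convex_growth[OF _ mid])
  then show ?thesis unfolding f_def H_variance_def .
qed

section \<open>Comparison of the limit point with the mean\<close>

text \<open>The estimate for a fixed number \<open>n\<close> of observations: the cycle from \<open>V\<close> to \<open>B\<close> to \<open>A\<close>
  and back to \<open>V\<close>, with explicit errors. The factor \<open>1/4\<close> on the left is the growth constant
  \<open>1/2\<close> halved by passing from \<open>d(z, \<mu>\<^sub>k)\<^sup>2\<close> to \<open>d(z, \<mu>)\<^sup>2\<close>. For fixed \<open>e\<close> the last two terms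
  on the right tend to \<open>0\<close> along the subsequence.\<close>

lemma dist_square_frechet_limit_bound:
  fixes X :: "nat \<Rightarrow> 'a \<Rightarrow> 'b::hadamard_space" and b :: "'a \<Rightarrow> 'b" and z \<mu> :: 'b
  assumes n: "n \<ge> 1"
    and X: "\<And>k. k \<ge> 1 \<Longrightarrow> X k \<in> L2 M"
    and b: "b \<in> L2 M"
    and b_eq: "\<And>w. w \<in> space M \<Longrightarrow> b w = frechet_mean n (\<lambda>k. X k w)"
    and var: "\<And>k. k \<ge> 1 \<Longrightarrow> H_variance M (X k) \<le> C"
    and e: "0 < e" "e \<le> 1"
  shows "(dist z \<mu>)\<^sup>2 / 4 \<le> 3 * e * C
    + ((1 + e) * (1 + 1/e) + 1/2) * ((1 / real n) * (\<Sum>k=1..n. (dist \<mu> (H_expectation M (X k)))\<^sup>2))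
    + (1 + 1/e) * (\<integral>w. (dist (b w) z)\<^sup>2 \<partial>M)"
proof -
  define F where "F = (\<lambda>y k. \<integral>w. (dist (X k w) y)\<^sup>2 \<partial>M)"
  define V where "V = (\<lambda>k. H_variance M (X k))"
  define g where "g = (\<lambda>k. (dist \<mu> (H_expectation M (X k)))\<^sup>2)"
  define D where "D = (\<integral>w. (dist (b w) z)\<^sup>2 \<partial>M)"
  define G where "G = (\<Sum>k=1..n. g k)"
  note int = L2_integrable_dist_square[OF X] L2_integrable_dist_square[OF b]

  have VB: "sum V {1..n} + real n * ((dist z \<mu>)\<^sup>2 / 4) - G / 2 \<le> sum (F z) {1..n}"
  proof -
    have "V k + (dist z \<mu>)\<^sup>2 / 4 - g k / 2 \<le> F z k" if "k \<in> {1..n}" for k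
    proof -
      define c where "c = H_expectation M (X k)"
      have "V k + (dist c z)\<^sup>2 / 2 \<le> F z k"
        using mean_square_growth[OF X, of k z] that unfolding V_def F_def c_def by simp
      moreover have "(dist z \<mu>)\<^sup>2 \<le> (1 + 1) * (dist z c)\<^sup>2 + (1 + 1/1) * (dist c \<mu>)\<^sup>2"
        by (rule dist_square_weighted_triangle) simp
      ultimately show ?thesis
        unfolding g_def c_def[symmetric] by (simp add: dist_commute)
    qed
    then have "(\<Sum>k=1..n. V k + (dist z \<mu>)\<^sup>2 / 4 - g k / 2) \<le> sum (F z) {1..n}"
      by (rule sum_mono)
    then show ?thesis
      unfolding G_def by (simp add: sum.distrib sum_subtractf sum_divide_distrib)
  qed

  have BA: "sum (F z) {1..n} \<le> (1 + e) * sum (F \<mu>) {1..n} + real n * ((1 + 1/e) * D)"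
  proof -
    have pw: "(\<Sum>k=1..n. (dist (X k w) z)\<^sup>2)
        \<le> (1 + e) * (\<Sum>k=1..n. (dist (X k w) \<mu>)\<^sup>2) + real n * ((1 + 1/e) * (dist (b w) z)\<^sup>2)"
      if w: "w \<in> space M" for w
    proof -
      have "(\<Sum>k=1..n. (dist (X k w) z)\<^sup>2)
          \<le> (\<Sum>k=1..n. (1 + e) * (dist (X k w) (b w))\<^sup>2 + (1 + 1/e) * (dist (b w) z)\<^sup>2)"
        by (intro sum_mono dist_square_weighted_triangle e)
      also have "\<dots> = (1 + e) * (\<Sum>k=1..n. (dist (X k w) (b w))\<^sup>2)
          + real n * ((1 + 1/e) * (dist (b w) z)\<^sup>2)"
        by (simp add: sum.distrib sum_distrib_left)
      also have "(1 + e) * (\<Sum>k=1..n. (dist (X k w) (b w))\<^sup>2)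
          \<le> (1 + e) * (\<Sum>k=1..n. (dist (X k w) \<mu>)\<^sup>2)"
        using frechet_mean_minimizes[OF n, of "\<lambda>k. X k w" \<mu>] e
        unfolding b_eq[OF w] by (intro mult_left_mono) auto
      finally show ?thesis by simp
    qed
    have "sum (F z) {1..n} = (\<integral>w. (\<Sum>k=1..n. (dist (X k w) z)\<^sup>2) \<partial>M)"
      unfolding F_def by (subst Bochner_Integration.integral_sum) (auto intro: int)
    also have "\<dots> \<le> (\<integral>w. (1 + e) * (\<Sum>k=1..n. (dist (X k w) \<mu>)\<^sup>2)
        + real n * ((1 + 1/e) * (dist (b w) z)\<^sup>2) \<partial>M)"
      by (intro integral_mono pw Bochner_Integration.integrable_add integrable_mult_right
          Bochner_Integration.integrable_sum int) auto
    also have "\<dots> = (1 + e) * (\<integral>w. (\<Sum>k=1..n. (dist (X k w) \<mu>)\<^sup>2) \<partial>M)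
        + real n * ((1 + 1/e) * D)"
      unfolding D_def
      by (subst Bochner_Integration.integral_add)
        (auto intro!: integrable_mult_right Bochner_Integration.integrable_sum int)
    also have "(\<integral>w. (\<Sum>k=1..n. (dist (X k w) \<mu>)\<^sup>2) \<partial>M) = sum (F \<mu>) {1..n}"
      unfolding F_def by (subst Bochner_Integration.integral_sum) (auto intro: int)
    finally show ?thesis .
  qed

  have AV: "sum (F \<mu>) {1..n} \<le> (1 + e) * sum V {1..n} + (1 + 1/e) * G"
  proof -
    have "F \<mu> k \<le> (1 + e) * V k + (1 + 1/e) * g k" if "k \<in> {1..n}" for k
      using mean_square_weighted_triangle[OF X e(1), of k \<mu> "H_expectation M (X k)"] that
      unfolding F_def V_def g_def H_variance_def by (simp add: dist_commute)
    then have "sum (F \<mu>) {1..n} \<le> (\<Sum>k=1..n. (1 + e) * V k + (1 + 1/e) * g k)"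
      by (rule sum_mono)
    then show ?thesis unfolding G_def by (simp only: sum.distrib sum_distrib_left[symmetric])
  qed

  have V_nonneg: "0 \<le> sum V {1..n}"
    unfolding V_def H_variance_def by (intro sum_nonneg) simp
  have V_le: "sum V {1..n} \<le> real n * C"
    using sum_bounded_above[of "{1..n}" V C] var unfolding V_def by simp
  have "e * e \<le> e" using e mult_left_le[of e e] by simp
  then have "((1 + e) * (1 + e) - 1) * sum V {1..n} \<le> (3 * e) * sum V {1..n}"
    by (intro mult_right_mono V_nonneg) (simp add: algebra_simps)
  also have "\<dots> \<le> (3 * e) * (real n * C)"
    using e by (intro mult_left_mono V_le) simp
  finally have V_err: "((1 + e) * (1 + e) - 1) * sum V {1..n} \<le> (3 * e) * (real n * C)" .
  have "(1 + e) * sum (F \<mu>) {1..n} \<le> (1 + e) * ((1 + e) * sum V {1..n} + (1 + 1/e) * G)"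
    using e by (intro mult_left_mono AV) simp
  also have "\<dots> = sum V {1..n} + ((1 + e) * (1 + e) - 1) * sum V {1..n}
      + (1 + e) * (1 + 1/e) * G"
    by (simp only: algebra_simps)
  finally have "real n * ((dist z \<mu>)\<^sup>2 / 4)
      \<le> (3 * e) * (real n * C) + ((1 + e) * (1 + 1/e) * G + G / 2) + real n * ((1 + 1/e) * D)"
    using VB BA V_err by linarith
  also have "(1 + e) * (1 + 1/e) * G + G / 2 = ((1 + e) * (1 + 1/e) + 1/2) * G"
    by (simp only: distrib_right)
  finally have "real n * ((dist z \<mu>)\<^sup>2 / 4)
      \<le> (3 * e) * (real n * C) + ((1 + e) * (1 + 1/e) + 1/2) * G + real n * ((1 + 1/e) * D)" .
  also have "\<dots> = real n * (3 * e * C + ((1 + e) * (1 + 1/e) + 1/2) * ((1 / real n) * G)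
      + (1 + 1/e) * D)"
    using n by (simp add: distrib_left)
  finally show ?thesis
    using n unfolding D_def G_def g_def by (subst (asm) mult_le_cancel_left_pos) auto
qed

end

theorem theorem2:
  fixes M :: "'w measure"
    and X b :: "nat \<Rightarrow> 'w \<Rightarrow> 'a::hadamard_space"
    and \<mu>s :: "nat \<Rightarrow> 'a"
    and \<mu> z :: 'a
    and r :: "nat \<Rightarrow> nat"
  assumes "prob_space M"
    and "\<And>n. n \<ge> 1 \<Longrightarrow> X n \<in> L2 M"
    and "\<And>n. n \<ge> 1 \<Longrightarrow> H_expectation M (X n) = \<mu>s n"
    and "\<And>n w. n \<ge> 1 \<Longrightarrow> w \<in> space M \<Longrightarrow> b n w = frechet_mean n (\<lambda>k. X k w)"
    and "bdd_above ((\<lambda>n. H_variance M (X n)) ` {1..})"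
    and "(\<lambda>n. (1 / real n) * (\<Sum>k=1..n. (dist \<mu> (\<mu>s k))\<^sup>2)) \<longlonglongrightarrow> 0"
    and "strict_mono r"
    and "\<And>m. r m \<ge> 1"
    and "L2_converges M (\<lambda>m. b (r m)) (\<lambda>w. z)"
  shows "z = \<mu>"
proof -
  interpret prob_space M by fact
  note X = assms(2) and mean = assms(3) and b = assms(4) and r = assms(7,8)
  obtain C where C: "\<And>n. n \<ge> 1 \<Longrightarrow> H_variance M (X n) \<le> C"
    using assms(5) unfolding bdd_above_def by auto
  have bL2: "b (r m) \<in> L2 M" for m
    using assms(9) unfolding L2_converges_def by auto
  define g where "g = (\<lambda>n. (1 / real n) * (\<Sum>k=1..n. (dist \<mu> (\<mu>s k))\<^sup>2))"
  define D where "D = (\<lambda>m. \<integral>w. (dist (b (r m) w) z)\<^sup>2 \<partial>M)"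
  have g: "(\<lambda>m. g (r m)) \<longlonglongrightarrow> 0"
    using LIMSEQ_subseq_LIMSEQ[OF assms(6) r(1)] unfolding g_def o_def .
  have "(\<integral>\<^sup>+w. ennreal ((dist (b (r m) w) z)\<^sup>2) \<partial>M) = ennreal (D m)" for m
    unfolding D_def by (intro nn_integral_eq_integral L2_integrable_dist_square bL2) auto
  then have "(\<lambda>m. ennreal (D m)) \<longlonglongrightarrow> ennreal 0"
    using assms(9) unfolding L2_converges_def by simp
  then have D: "D \<longlonglongrightarrow> 0"
    by (rule tendsto_ennrealD) (auto simp: D_def)
  have bound: "(dist z \<mu>)\<^sup>2 / 4 \<le> 3 * e * C" if e: "0 < e" "e \<le> 1" for e
  proof (rule LIMSEQ_le_const)
    have "(\<lambda>m. 3 * e * C + ((1 + e) * (1 + 1/e) + 1/2) * g (r m) + (1 + 1/e) * D m)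
        \<longlonglongrightarrow> 3 * e * C + ((1 + e) * (1 + 1/e) + 1/2) * 0 + (1 + 1/e) * 0"
      by (intro tendsto_add tendsto_mult tendsto_const g D)
    then show "(\<lambda>m. 3 * e * C + ((1 + e) * (1 + 1/e) + 1/2) * g (r m) + (1 + 1/e) * D m)
        \<longlonglongrightarrow> 3 * e * C" by simp
    have "(dist z \<mu>)\<^sup>2 / 4
        \<le> 3 * e * C + ((1 + e) * (1 + 1/e) + 1/2) * g (r m) + (1 + 1/e) * D m" for m
    proof -
      have "g (r m) = (1 / real (r m)) * (\<Sum>k=1..r m. (dist \<mu> (H_expectation M (X k)))\<^sup>2)"
        unfolding g_def by (intro arg_cong2[where f = times] sum.cong refl) (simp add: mean)
      then show ?thesis
        unfolding D_def
        by (simp only:) (rule dist_square_frechet_limit_bound[OF r(2) X bL2 b[OF r(2)] C e])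
    qed
    then show "\<exists>N. \<forall>m\<ge>N. (dist z \<mu>)\<^sup>2 / 4
        \<le> 3 * e * C + ((1 + e) * (1 + 1/e) + 1/2) * g (r m) + (1 + 1/e) * D m" by blast
  qed
  have "((\<lambda>e. 3 * e * C) \<longlongrightarrow> 3 * 0 * C) (at_right 0)" by (intro tendsto_intros)
  moreover have "\<forall>\<^sub>F e in at_right 0. (dist z \<mu>)\<^sup>2 / 4 \<le> 3 * e * C"
    by (rule eventually_mono[OF eventually_at_right_real[of 0 1]], simp, rule bound) simp_all
  ultimately have "(dist z \<mu>)\<^sup>2 / 4 \<le> 3 * 0 * C"
    by (rule tendsto_lowerbound) simp
  then show "z = \<mu>" by simp
qed

end
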